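(* Let $G$ be an arbitrary topological group and let $X$ be a (compact) metric RN $G$-system. Then either the enveloping semigroup $E=E(X)$ contains an uncountable discrete subspace, or it admits a metric $G$-factor $\pi:(G,E)\to(G,Y)$ such that $|\pi^{-1}(y)|\le 2$ for every $y\in Y$.
   Context: A compact $G$-system is a compact Hausdorff space with a (jointly) continuous left action of the topological group $G$; it is metric if the space is metrizable. For a compact $G$-system $X$ let $\breve g:X\to X$, $x\mapsto gx$. The enveloping semigroup $E(X)$ is the closure of $\{\breve g:g\in G\}$ in $X^X$ with the pointwise convergence topology; it is a compact $G$-system under $gp=\breve g\circ p$. A $G$-factor $\pi:E\to Y$ is a continuous surjective $G$-equivariant map onto a compact $G$-system $Y$; it is metric if $Y$ is metrizable. RN: a Banach space $V$ is Asplund if every separable Banach subspace has separable dual. $\mathrm{Iso}(V)$ is the group of linear isometries of $V$ onto itself. $X$ is Radon-Nikodým (RN) if there exist an Asplund space $V$, a strongly continuous co-homomorphism $h:G\to\mathrm{Iso}(V)$ (i.e. $h(gg')=h(g')h(g)$, and $g\mapsto h(g)v$ is norm continuous for each $v$), and a bounded topological embedding $\alpha:X\to(V^*,\text{weak}^* )$ with $\alpha(gx)=g\alpha(x)$, where $(g\varphi)(v)=\varphi(h(g)(v))$. *)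

theory Defs
  imports "HOL-Analysis.Analysis"
begin

text \<open>
  Topological groups are types of class \<open>topological_group_add\<close>: the group operation is
  written additively, but it is not assumed to be commutative, and the topology is not assumed
  to be Hausdorff.
\<close>

subsection \<open>Compact \<open>G\<close>-systems and the enveloping semigroup\<close>

definition compact_G_system :: "'x topology \<Rightarrow> ('g::topological_group_add \<Rightarrow> 'x \<Rightarrow> 'x) \<Rightarrow> bool" where
  "compact_G_system X act \<longleftrightarrow>
     compact_space X \<and> Hausdorff_space X \<and>
     (\<forall>x\<in>topspace X. act 0 x = x) \<and>
     (\<forall>g g'. \<forall>x\<in>topspace X. act (g + g') x = act g (act g' x)) \<and>
     continuous_map (prod_topology euclidean X) X (\<lambda>(g, x). act g x)"

text \<open>
  The points of the space of all selfmaps of \<open>X\<close> are represented by extensional functions on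
  \<open>topspace X\<close>, as usual for \<^const>\<open>product_topology\<close>; hence the restriction of the translations.
\<close>

definition enveloping_semigroup ::
    "'x topology \<Rightarrow> ('g::topological_group_add \<Rightarrow> 'x \<Rightarrow> 'x) \<Rightarrow> ('x \<Rightarrow> 'x) topology" where
  "enveloping_semigroup X act =
     (let P = product_topology (\<lambda>_. X) (topspace X)
      in subtopology P (P closure_of range (\<lambda>g. restrict (act g) (topspace X))))"

definition enveloping_act ::
    "'x topology \<Rightarrow> ('g::topological_group_add \<Rightarrow> 'x \<Rightarrow> 'x) \<Rightarrow> 'g \<Rightarrow> ('x \<Rightarrow> 'x) \<Rightarrow> ('x \<Rightarrow> 'x)" where
  "enveloping_act X act g p = compose (topspace X) (act g) p"

text \<open>
  Every factor of a system \<open>X\<close> on a type \<open>'x\<close> is isomorphic to one whose points are the fibres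
  of the factor map, so \<open>there is a factor of X such that\<close> may be expressed by quantifying over
  topologies on the type \<open>'x set\<close>.
\<close>

definition G_factor ::
    "'x topology \<Rightarrow> ('g::topological_group_add \<Rightarrow> 'x \<Rightarrow> 'x) \<Rightarrow>
     'y topology \<Rightarrow> ('g \<Rightarrow> 'y \<Rightarrow> 'y) \<Rightarrow> ('x \<Rightarrow> 'y) \<Rightarrow> bool" where
  "G_factor X act Y act' \<pi> \<longleftrightarrow>
     compact_G_system Y act' \<and>
     continuous_map X Y \<pi> \<and> \<pi> ` topspace X = topspace Y \<and>
     (\<forall>g. \<forall>x\<in>topspace X. \<pi> (act g x) = act' g (\<pi> x))"

lemma compact_G_system_enveloping_semigroup:
  assumes "compact_G_system X act"
  shows "compact_G_system (enveloping_semigroup X act) (enveloping_act X act)"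
proof -
  define P where "P = product_topology (\<lambda>_::'a. X) (topspace X)"
  define T where "T = range (\<lambda>g. restrict (act g) (topspace X))"
  define S where "S = P closure_of T"
  have E: "enveloping_semigroup X act = subtopology P S"
    by (simp add: enveloping_semigroup_def P_def S_def T_def Let_def)
  have cX: "compact_space X" and hX: "Hausdorff_space X"
    and a0: "\<And>x. x \<in> topspace X \<Longrightarrow> act 0 x = x"
    and aa: "\<And>g g' x. x \<in> topspace X \<Longrightarrow> act (g + g') x = act g (act g' x)"
    and cont: "continuous_map (prod_topology euclidean X) X (\<lambda>(g, x). act g x)"
    using assms by (auto simp: compact_G_system_def)
  have inX: "act g x \<in> topspace X" if "x \<in> topspace X" for g x
    using continuous_map_image_subset_topspace[OF cont] that by force
  have tP: "topspace P = topspace X \<rightarrow>\<^sub>E topspace X"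
    by (simp add: P_def)
  have SP: "S \<subseteq> topspace P"
    by (simp add: S_def closure_of_subset_topspace)
  have contP: "continuous_map (prod_topology euclidean P) P (\<lambda>(g, p). enveloping_act X act g p)"
  proof -
    have "continuous_map (prod_topology euclidean P) X (\<lambda>z. (case z of (g, p) \<Rightarrow> enveloping_act X act g p) x)"
      if x: "x \<in> topspace X" for x
    proof -
      have "continuous_map (prod_topology euclidean P) X (\<lambda>z. snd z x)"
        using continuous_map_compose[OF continuous_map_snd continuous_map_product_projection[OF x, of "\<lambda>_. X"]]
        by (simp add: P_def o_def)
      then have "continuous_map (prod_topology euclidean P) (prod_topology euclidean X) (\<lambda>z. (fst z, snd z x))"
        by (intro continuous_map_pairedI continuous_map_fst)
      from continuous_map_compose[OF this cont]
      show ?thesis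
        using x by (simp add: o_def enveloping_act_def compose_def case_prod_beta)
    qed
    then show ?thesis
      unfolding P_def continuous_map_componentwise
      by (simp add: case_prod_beta image_subset_iff enveloping_act_def compose_def)
  qed
  have contg: "continuous_map P P (enveloping_act X act g)" for g
    using continuous_map_compose[OF _ contP, of P "\<lambda>p. (g, p)"]
    by (simp add: o_def continuous_map_pairedI)
  have sub: "enveloping_act X act g ` T \<subseteq> T" for g
  proof -
    have "enveloping_act X act g (restrict (act g') (topspace X)) = restrict (act (g + g')) (topspace X)" for g'
      by (rule ext) (simp add: enveloping_act_def compose_def aa)
    then show ?thesis
      unfolding T_def by auto
  qed
  have inS: "enveloping_act X act g p \<in> S" if "p \<in> S" for g p
    using continuous_map_image_closure_subset[OF contg, of g T] closure_of_mono[OF sub, of P g] that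
    unfolding S_def by blast
  have "compact_space P"
    by (simp add: P_def compact_space_product_topology cX)
  then have "compact_space (subtopology P S)"
    by (simp add: S_def closedin_compact_space compact_space_subtopology)
  moreover have "Hausdorff_space (subtopology P S)"
    by (simp add: P_def Hausdorff_space_product_topology hX Hausdorff_space_subtopology)
  moreover have "enveloping_act X act 0 p = p" if "p \<in> topspace P" for p
    using that a0 by (fastforce simp: tP enveloping_act_def compose_def PiE_def extensional_def)
  moreover have "enveloping_act X act (g + g') p = enveloping_act X act g (enveloping_act X act g' p)"
    if "p \<in> topspace P" for g g' p
    using that aa by (fastforce simp: tP enveloping_act_def compose_def)
  moreover have "continuous_map (prod_topology euclidean (subtopology P S)) (subtopology P S)
      (\<lambda>(g, p). enveloping_act X act g p)"
  proof -
    have eq: "prod_topology euclidean (subtopology P S) = subtopology (prod_topology euclidean P) (UNIV \<times> S)"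
      unfolding prod_topology_subtopology(2) topspace_euclidean ..
    have "(\<lambda>(g, p). enveloping_act X act g p) ` topspace (prod_topology euclidean (subtopology P S)) \<subseteq> S"
      using inS by auto
    then show ?thesis
      using continuous_map_from_subtopology[OF contP, of "UNIV \<times> S"]
      unfolding continuous_map_in_subtopology eq by blast
  qed
  ultimately show ?thesis
    unfolding E compact_G_system_def by auto
qed

subsection \<open>Asplund spaces\<close>

text \<open>
  The dual of a linear subspace \<open>W\<close> of a normed space, with functionals represented as
  extensional functions on \<open>W\<close>, and its operator norm.
\<close>

definition subspace_dual :: "'v::real_normed_vector set \<Rightarrow> ('v \<Rightarrow> real) set" where
  "subspace_dual W =
     {f \<in> extensional W.
        (\<forall>x\<in>W. \<forall>y\<in>W. f (x + y) = f x + f y) \<and>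
        (\<forall>c. \<forall>x\<in>W. f (c *\<^sub>R x) = c * f x) \<and>
        (\<exists>K. \<forall>x\<in>W. \<bar>f x\<bar> \<le> K * norm x)}"

text \<open>
  The distance of the operator norm. The locale \<open>Metric_space\<close> requires nonnegativity also for
  arguments outside the carrier, where the supremum need not exist; the value \<open>0\<close> there is
  immaterial.
\<close>

definition subspace_dual_dist :: "'v::real_normed_vector set \<Rightarrow> ('v \<Rightarrow> real) \<Rightarrow> ('v \<Rightarrow> real) \<Rightarrow> real" where
  "subspace_dual_dist W f f' =
     (if f \<in> subspace_dual W \<and> f' \<in> subspace_dual W
      then SUP x\<in>{x\<in>W. norm x \<le> 1}. \<bar>f x - f' x\<bar> else 0)"

lemma Metric_space_subspace_dual:
  assumes W: "subspace W"
  shows "Metric_space (subspace_dual W) (subspace_dual_dist W)"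
proof -
  let ?B = "{x\<in>W. norm x \<le> 1}"
  have B0: "0 \<in> ?B" using W by (simp add: subspace_0)
  have bdd: "bdd_above ((\<lambda>x. \<bar>f x - f' x\<bar>) ` ?B)"
    if f: "f \<in> subspace_dual W" "f' \<in> subspace_dual W" for f f'
  proof -
    obtain K K' where K: "\<forall>x\<in>W. \<bar>f x\<bar> \<le> K * norm x" "\<forall>x\<in>W. \<bar>f' x\<bar> \<le> K' * norm x"
      using f by (auto simp: subspace_dual_def)
    have "\<bar>f x - f' x\<bar> \<le> \<bar>K\<bar> + \<bar>K'\<bar>" if x: "x \<in> ?B" for x
    proof -
      have "\<bar>f x\<bar> \<le> \<bar>K\<bar> * norm x" "\<bar>f' x\<bar> \<le> \<bar>K'\<bar> * norm x"
        using K x by (smt (verit) mem_Collect_eq mult_right_mono norm_ge_zero)+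
      moreover have "\<bar>K\<bar> * norm x \<le> \<bar>K\<bar>" "\<bar>K'\<bar> * norm x \<le> \<bar>K'\<bar>"
        using x by (simp_all add: mult_left_le)
      ultimately show ?thesis by linarith
    qed
    then show ?thesis by (meson bdd_aboveI2)
  qed
  have up: "\<bar>f x - f' x\<bar> \<le> subspace_dual_dist W f f'"
    if "f \<in> subspace_dual W" "f' \<in> subspace_dual W" "x \<in> ?B" for f f' x
    using cSUP_upper[OF that(3) bdd[OF that(1,2)]] that by (simp add: subspace_dual_dist_def)
  have least: "subspace_dual_dist W f f' \<le> c"
    if "f \<in> subspace_dual W" "f' \<in> subspace_dual W" "\<And>x. x \<in> ?B \<Longrightarrow> \<bar>f x - f' x\<bar> \<le> c" for f f' c
  proof -
    have "(SUP x\<in>?B. \<bar>f x - f' x\<bar>) \<le> c"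
      using B0 that(3) by (intro cSUP_least) blast+
    then show ?thesis using that by (simp add: subspace_dual_dist_def)
  qed
  show ?thesis
  proof
    fix f f' :: "'a \<Rightarrow> real"
    show "subspace_dual_dist W f f' = subspace_dual_dist W f' f"
      by (simp add: subspace_dual_dist_def abs_minus_commute)
    show "0 \<le> subspace_dual_dist W f f'"
    proof (cases "f \<in> subspace_dual W \<and> f' \<in> subspace_dual W")
      case True
      then show ?thesis using up[OF _ _ B0, of f f'] by linarith
    qed (auto simp: subspace_dual_dist_def)
  next
    fix f f' assume f: "f \<in> subspace_dual W" "f' \<in> subspace_dual W"
    show "subspace_dual_dist W f f' = 0 \<longleftrightarrow> f = f'"
    proof
      assume 0: "subspace_dual_dist W f f' = 0"
      have "f x = f' x" if x: "x \<in> W" for x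
      proof -
        define c where "c = inverse (1 + norm x)"
        have c: "c > 0" by (simp add: c_def add_pos_nonneg)
        have "norm (c *\<^sub>R x) \<le> 1"
          by (simp add: c_def divide_simps add_pos_nonneg)
        then have "c *\<^sub>R x \<in> ?B" using W x by (simp add: subspace_scale)
        from up[OF f this] have "f (c *\<^sub>R x) = f' (c *\<^sub>R x)" using 0 by simp
        then have "c * f x = c * f' x" using f x by (simp add: subspace_dual_def)
        then show ?thesis using c by simp
      qed
      then show "f = f'"
        using f by (intro extensionalityI[of f W]) (auto simp: subspace_dual_def)
    next
      assume "f = f'"
      then show "subspace_dual_dist W f f' = 0"
        using least[OF f, of 0] up[OF f B0] by simp
    qed
  next
    fix f f' f'' assume f: "f \<in> subspace_dual W" "f' \<in> subspace_dual W" "f'' \<in> subspace_dual W"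
    show "subspace_dual_dist W f f'' \<le> subspace_dual_dist W f f' + subspace_dual_dist W f' f''"
    proof (rule least[OF f(1,3)])
      fix x assume x: "x \<in> ?B"
      show "\<bar>f x - f'' x\<bar> \<le> subspace_dual_dist W f f' + subspace_dual_dist W f' f''"
        using up[OF f(1,2) x] up[OF f(2,3) x] by linarith
    qed
  qed
qed

text \<open>The Banach subspaces of a Banach space are its closed linear subspaces.\<close>

definition Asplund :: "'v::banach itself \<Rightarrow> bool" where
  "Asplund _ \<longleftrightarrow>
     (\<forall>W::'v set. subspace W \<and> closed W \<and> separable_space (top_of_set W) \<longrightarrow>
        separable_space (Metric_space.mtopology (subspace_dual W) (subspace_dual_dist W)))"

subsection \<open>Radon--Nikodym systems\<close>

definition linear_isometry_onto :: "('v::real_normed_vector \<Rightarrow> 'v) \<Rightarrow> bool" where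
  "linear_isometry_onto f \<longleftrightarrow> linear f \<and> (\<forall>v. norm (f v) = norm v) \<and> surj f"

text \<open>The topology of pointwise convergence on the dual.\<close>

abbreviation weak_star_topology :: "('v::real_normed_vector \<Rightarrow>\<^sub>L real) topology" where
  "weak_star_topology \<equiv> strong_operator_topology"

definition strongly_continuous_cohom ::
    "('g::topological_group_add \<Rightarrow> 'v::real_normed_vector \<Rightarrow> 'v) \<Rightarrow> bool" where
  "strongly_continuous_cohom h \<longleftrightarrow>
     (\<forall>g. linear_isometry_onto (h g)) \<and>
     (\<forall>g g'. h (g + g') = h g' \<circ> h g) \<and>
     (\<forall>v. continuous_on UNIV (\<lambda>g. h g v))"

text \<open>
  Types cannot be quantified inside a formula, so the Banach space \<open>V\<close> of the representation is
  a parameter: a system is RN iff \<open>RN_system_on\<close> holds for some Banach space \<open>V\<close>. A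
  theorem with this predicate as a hypothesis and an arbitrary type of class \<open>banach\<close> covers
  all RN systems.
\<close>

definition RN_system_on ::
    "'v::banach itself \<Rightarrow> 'x topology \<Rightarrow> ('g::topological_group_add \<Rightarrow> 'x \<Rightarrow> 'x) \<Rightarrow> bool" where
  "RN_system_on V X act \<longleftrightarrow>
     compact_G_system X act \<and> Asplund V \<and>
     (\<exists>(h :: 'g \<Rightarrow> 'v \<Rightarrow> 'v) (\<alpha> :: 'x \<Rightarrow> ('v \<Rightarrow>\<^sub>L real)).
        strongly_continuous_cohom h \<and>
        embedding_map X weak_star_topology \<alpha> \<and> bounded (\<alpha> ` topspace X) \<and>
        (\<forall>g. \<forall>x\<in>topspace X. \<forall>v. blinfun_apply (\<alpha> (act g x)) v = blinfun_apply (\<alpha> x) (h g v)))"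

end

theory Submission
  imports Defs
begin

text \<open>
  The second alternative holds, even with an injective \<open>\<pi>\<close>, because the enveloping semigroup
  \<open>E(X)\<close> of a metrizable RN system is itself metrizable. Let \<open>\<alpha>\<close> be the embedding of \<open>X\<close> into
  the dual of an Asplund space.

  The first ingredient is that \<open>\<alpha>(X)\<close> is norm separable
  (\<open>Asplund_imp_norm_separable_image\<close>). The points of the unit ball define
  continuous functions on the second countable space \<open>X\<close>, so countably many of them are pointwise
  dense among all of them (\<open>countable_pointwise_dense_subfamily\<close>). Let \<open>W\<close> be a separable closed
  subspace that contains these countably many points. Then the norm of \<open>\<alpha> x - \<alpha> y\<close> does not
  change under restriction to \<open>W\<close>, so \<open>\<alpha>(X)\<close> is isometric to a subset of the dual of \<open>W\<close>, which is
  norm separable by the Asplund property.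

  The second ingredient is that the group acts by isometries, so that for each vector \<open>v\<close> the functions
  \<open>x \<mapsto> \<alpha> (g x) v\<close> are all Lipschitz with constant \<open>norm v\<close> for the norm distance of \<open>\<alpha> x\<close> and
  \<open>\<alpha> y\<close>. This bound is preserved by pointwise limits. Hence an element of \<open>E(X)\<close> is determined by its
  values on a countable set \<open>D\<close> with \<open>\<alpha>(D)\<close> norm dense in \<open>\<alpha>(X)\<close>, and the compact space \<open>E(X)\<close>
  embeds into the metrizable space \<open>X\<close> to the power \<open>D\<close> (\<open>metrizable_enveloping_semigroup\<close>).
\<close>

section \<open>Countability in metric spaces and spaces of continuous functions\<close>

lemma (in Metric_space) second_countable_mtopology:
  assumes "separable_space mtopology"
  shows "second_countable mtopology"
proof -
  obtain C where C: "countable C" "C \<subseteq> M" "mtopology closure_of C = M"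
    using assms by (auto simp: separable_space_def)
  define \<B> where "\<B> = (\<lambda>(c, r). mball c r) ` (C \<times> \<rat>)"
  have "\<exists>V\<in>\<B>. x \<in> V \<and> V \<subseteq> U" if U: "openin mtopology U" and x: "x \<in> U" for U x
  proof -
    obtain r where r: "r > 0" "mball x r \<subseteq> U"
      using U x by (auto simp: openin_mtopology)
    obtain q where q: "q \<in> \<rat>" "0 < q" "q < r / 2"
      using Rats_dense_in_real[of 0 "r / 2"] r by auto
    have xM: "x \<in> M"
      using U x openin_mtopology by blast
    then have "x \<in> mtopology closure_of C"
      by (simp add: C)
    then obtain c where c: "c \<in> C" "c \<in> mball x q"
      unfolding metric_closure_of using q by auto
    have "x \<in> mball c q"
      using c C xM by (auto simp: commute)
    moreover have "mball c q \<subseteq> mball x r"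
    proof (rule mball_subset)
      show "d c x + q \<le> r"
        using c q by (auto simp: commute)
    qed (fact xM)
    moreover have "mball c q \<in> \<B>"
      using c q by (auto simp: \<B>_def)
    ultimately show ?thesis
      using r by blast
  qed
  moreover have "countable \<B>" "\<forall>V\<in>\<B>. openin mtopology V"
    using C by (auto simp: \<B>_def countable_rat)
  ultimately show ?thesis
    unfolding second_countable_def by blast
qed

lemma compact_metrizable_imp_second_countable:
  assumes "compact_space X" "metrizable_space X"
  shows "second_countable X"
proof -
  obtain M d where M: "Metric_space M d" and X: "X = Metric_space.mtopology M d"
    using assms by (auto simp: metrizable_space_def)
  interpret Metric_space M d by fact
  have "mtotally_bounded M"
    using assms compactin_imp_mtotally_bounded by (simp add: X compact_space_def)
  then have "\<exists>K. finite K \<and> K \<subseteq> M \<and> M \<subseteq> (\<Union>x\<in>K. mball x (inverse (Suc n)))" for n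
    by (simp add: mtotally_bounded_def)
  then obtain K where K: "\<And>n. finite (K n)" "\<And>n. K n \<subseteq> M"
      "\<And>n. M \<subseteq> (\<Union>x\<in>K n. mball x (inverse (Suc n)))"
    by metis
  have "separable_space mtopology"
    unfolding separable_space_def
  proof (intro exI conjI)
    show "countable (\<Union>n. K n)"
      using K(1) by (simp add: countable_finite)
    show "(\<Union>n. K n) \<subseteq> topspace mtopology"
      using K(2) by auto
    have "\<exists>y\<in>\<Union>n. K n. y \<in> mball x r" if x: "x \<in> M" and r: "r > 0" for x r
    proof -
      obtain n where n: "inverse (Suc n) < r"
        using r reals_Archimedean by blast
      obtain y where "y \<in> K n" "x \<in> mball y (inverse (Suc n))"
        using K(3)[of n] x by blast
      then show ?thesis
        using n by (force simp: commute)
    qed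
    then show "mtopology closure_of (\<Union>n. K n) = topspace mtopology"
      unfolding metric_closure_of by auto
  qed
  then show ?thesis
    unfolding X by (rule second_countable_mtopology)
qed

text \<open>
  This is hereditary separability of the space of continuous functions with the pointwise topology.
  Given \<open>F\<close> and \<open>e\<close>, the approximation of \<open>f i\<close> on \<open>F\<close> follows from finitely many conditions of
  the form that a basic open set is mapped into a rational interval. There are only countably many
  finite sets of such conditions, so one member of the family for each satisfiable set suffices.
\<close>

lemma countable_pointwise_dense_subfamily:
  fixes f :: "'i \<Rightarrow> 'x \<Rightarrow> real"
  assumes X: "second_countable X"
    and f: "\<And>i. i \<in> I \<Longrightarrow> continuous_map X euclidean (f i)"
  obtains J where "J \<subseteq> I" "countable J"
    "\<And>i F e. i \<in> I \<Longrightarrow> finite F \<Longrightarrow> F \<subseteq> topspace X \<Longrightarrow> e > 0 \<Longrightarrow> \<exists>j\<in>J. \<forall>x\<in>F. \<bar>f j x - f i x\<bar> < e"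
proof -
  obtain \<B> where \<B>: "countable \<B>"
      "\<And>U x. openin X U \<Longrightarrow> x \<in> U \<Longrightarrow> \<exists>V\<in>\<B>. x \<in> V \<and> V \<subseteq> U"
    using X by (metis second_countable_def)
  \<comment> \<open>\<open>N T\<close> collects the indices that satisfy the finite set \<open>T\<close> of conditions.\<close>
  define N where "N T = {i\<in>I. \<forall>(U, a, b)\<in>T. \<forall>x\<in>U. a < f i x \<and> f i x < b}" for T
  define \<T> where "\<T> = {T. finite T \<and> T \<subseteq> \<B> \<times> \<rat> \<times> \<rat> \<and> N T \<noteq> {}}"
  define J where "J = (\<lambda>T. SOME i. i \<in> N T) ` \<T>"
  have someN: "(SOME i. i \<in> N T) \<in> N T" if "T \<in> \<T>" for T
    using that by (simp add: \<T>_def some_in_eq)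
  have "countable \<T>"
  proof (rule countable_subset)
    show "\<T> \<subseteq> {T. finite T \<and> T \<subseteq> \<B> \<times> \<rat> \<times> \<rat>}"
      by (auto simp: \<T>_def)
    show "countable {T. finite T \<and> T \<subseteq> \<B> \<times> \<rat> \<times> (\<rat>::real set)}"
      by (intro countable_Collect_finite_subset countable_SIGMA \<B> countable_rat)
  qed
  then have "countable J"
    by (simp add: J_def)
  have "J \<subseteq> I"
    using someN by (auto simp: J_def N_def)
  moreover note \<open>countable J\<close>
  moreover have "\<exists>j\<in>J. \<forall>x\<in>F. \<bar>f j x - f i x\<bar> < e"
    if i: "i \<in> I" and F: "finite F" "F \<subseteq> topspace X" and e: "e > 0" for i F and e :: real
  proof -
    have "\<exists>U a b. U \<in> \<B> \<and> a \<in> \<rat> \<and> b \<in> \<rat> \<and> x \<in> U \<and> f i x - e < a \<and> b < f i x + e \<and>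
        (\<forall>y\<in>U. a < f i y \<and> f i y < b)" if x: "x \<in> F" for x
    proof -
      obtain a b where a: "a \<in> \<rat>" "f i x - e < a" "a < f i x"
        and b: "b \<in> \<rat>" "f i x < b" "b < f i x + e"
        using Rats_dense_in_real[of "f i x - e" "f i x"] Rats_dense_in_real[of "f i x" "f i x + e"] e
        by auto
      have "openin X {y\<in>topspace X. f i y \<in> {a<..<b}}"
        using openin_continuous_map_preimage[OF f[OF i], of "{a<..<b}"] by simp
      moreover have "x \<in> {y\<in>topspace X. f i y \<in> {a<..<b}}"
        using x F a b by auto
      ultimately obtain U where "U \<in> \<B>" "x \<in> U" "U \<subseteq> {y\<in>topspace X. f i y \<in> {a<..<b}}"
        using \<B>(2) by blast
      then show ?thesis
        using a b by (intro exI[of _ U] exI[of _ a] exI[of _ b]) auto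
    qed
    then obtain U a b where *: "\<forall>x\<in>F. U x \<in> \<B> \<and> a x \<in> \<rat> \<and> b x \<in> \<rat> \<and> x \<in> U x \<and>
        f i x - e < a x \<and> b x < f i x + e \<and> (\<forall>y\<in>U x. a x < f i y \<and> f i y < b x)"
      unfolding Ball_def by metis
    then have U: "\<And>x. x \<in> F \<Longrightarrow> U x \<in> \<B>" "\<And>x. x \<in> F \<Longrightarrow> x \<in> U x"
      and ab: "\<And>x. x \<in> F \<Longrightarrow> a x \<in> \<rat> \<and> b x \<in> \<rat> \<and> f i x - e < a x \<and> b x < f i x + e"
      and fU: "\<And>x y. x \<in> F \<Longrightarrow> y \<in> U x \<Longrightarrow> a x < f i y \<and> f i y < b x"
      by blast+
    define T where "T = (\<lambda>x. (U x, a x, b x)) ` F"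
    have "i \<in> N T"
      using i fU by (simp add: N_def T_def)
    then have T: "T \<in> \<T>"
      using F U(1) ab by (auto simp: \<T>_def T_def)
    define j where "j = (SOME i. i \<in> N T)"
    have "j \<in> J"
      using T by (simp add: J_def j_def)
    moreover have "\<bar>f j x - f i x\<bar> < e" if x: "x \<in> F" for x
    proof -
      have "j \<in> N T"
        unfolding j_def by (rule someN[OF T])
      then have "a x < f j x \<and> f j x < b x"
        using x U(2)[OF x] by (simp add: N_def T_def)
      then show ?thesis
        using ab[OF x] by linarith
    qed
    ultimately show ?thesis
      by blast
  qed
  ultimately show thesis
    by (rule that)
qed

section \<open>Norm separability in duals of Asplund spaces\<close>

text \<open>
  The closure of the set of rational combinations of \<open>C\<close> is a real subspace, since both
  scalars and vectors can be approximated.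
\<close>

lemma ex_separable_subspace_superset:
  fixes C :: "'v::real_normed_vector set"
  assumes C: "countable C"
  obtains W where "subspace W" "closed W" "separable_space (top_of_set W)" "C \<subseteq> W"
proof -
  define Q where "Q = (\<lambda>l. \<Sum>(q, c)\<leftarrow>l. q *\<^sub>R c) ` lists (\<rat> \<times> C)"
  have Q0: "0 \<in> Q"
    by (force simp: Q_def intro: image_eqI[of _ _ "[]"])
  have Qadd: "x + y \<in> Q" if x: "x \<in> Q" and y: "y \<in> Q" for x y
  proof -
    obtain k l where "k \<in> lists (\<rat> \<times> C)" "x = (\<Sum>(q, c)\<leftarrow>k. q *\<^sub>R c)"
      "l \<in> lists (\<rat> \<times> C)" "y = (\<Sum>(q, c)\<leftarrow>l. q *\<^sub>R c)"
      using x y unfolding Q_def by blast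
    then show ?thesis
      unfolding Q_def by (intro image_eqI[of _ _ "k @ l"]) auto
  qed
  have Qscale: "r *\<^sub>R x \<in> Q" if r: "r \<in> \<rat>" and x: "x \<in> Q" for r x
  proof -
    obtain l where l: "l \<in> lists (\<rat> \<times> C)" "x = (\<Sum>(q, c)\<leftarrow>l. q *\<^sub>R c)"
      using x unfolding Q_def by blast
    have "r *\<^sub>R (\<Sum>(q, c)\<leftarrow>l. q *\<^sub>R c) = (\<Sum>(q, c)\<leftarrow>map (\<lambda>(q, c). (r * q, c)) l. q *\<^sub>R c)"
      by (induction l) (auto simp: scaleR_add_right)
    moreover have "map (\<lambda>(q, c). (r * q, c)) l \<in> lists (\<rat> \<times> C)"
      using l(1) r by (auto simp: lists_eq_set)
    ultimately show ?thesis
      unfolding Q_def l(2) by (rule image_eqI)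
  qed
  have "C \<subseteq> Q"
  proof
    fix c assume "c \<in> C"
    then show "c \<in> Q"
      unfolding Q_def by (intro image_eqI[of _ _ "[(1, c)]"]) auto
  qed
  have "subspace (closure Q)"
    unfolding subspace_def
  proof (intro conjI ballI allI)
    show "0 \<in> closure Q"
      using Q0 closure_subset by blast
  next
    fix x y assume "x \<in> closure Q" "y \<in> closure Q"
    then obtain u v where "\<forall>n. u n \<in> Q" "u \<longlonglongrightarrow> x" "\<forall>n. v n \<in> Q" "v \<longlonglongrightarrow> y"
      by (auto simp: closure_sequential)
    then have "\<forall>n. u n + v n \<in> Q" "(\<lambda>n. u n + v n) \<longlonglongrightarrow> x + y"
      by (auto intro: Qadd tendsto_add)
    then show "x + y \<in> closure Q"
      unfolding closure_sequential by (intro exI[of _ "\<lambda>n. u n + v n"] conjI)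
  next
    fix r :: real and x assume "x \<in> closure Q"
    then obtain u where u: "\<forall>n. u n \<in> Q" "u \<longlonglongrightarrow> x"
      by (auto simp: closure_sequential)
    have "r \<in> closure \<rat>"
      by (simp add: Rats_closure_real)
    then obtain s where "\<forall>n. s n \<in> \<rat>" "s \<longlonglongrightarrow> r"
      unfolding closure_sequential by blast
    then have "\<forall>n. s n *\<^sub>R u n \<in> Q" "(\<lambda>n. s n *\<^sub>R u n) \<longlonglongrightarrow> r *\<^sub>R x"
      using u by (auto intro: Qscale tendsto_scaleR)
    then show "r *\<^sub>R x \<in> closure Q"
      unfolding closure_sequential by (intro exI[of _ "\<lambda>n. s n *\<^sub>R u n"] conjI)
  qed
  moreover have "separable_space (top_of_set (closure Q))"
    unfolding separable_space_def
  proof (intro exI conjI)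
    show "countable Q"
      by (simp add: Q_def C countable_rat)
    show "Q \<subseteq> topspace (top_of_set (closure Q))"
      by (simp add: closure_subset)
    show "top_of_set (closure Q) closure_of Q = topspace (top_of_set (closure Q))"
      by (simp add: closure_of_subtopology Int_absorb1 closure_subset)
  qed
  moreover have "C \<subseteq> closure Q"
    using \<open>C \<subseteq> Q\<close> closure_subset by blast
  ultimately show thesis
    by (intro that[of "closure Q"]) auto
qed

lemma restrict_blinfun_in_subspace_dual:
  fixes \<phi> :: "'v::real_normed_vector \<Rightarrow>\<^sub>L real"
  assumes "subspace W"
  shows "restrict (blinfun_apply \<phi>) W \<in> subspace_dual W"
proof -
  have "\<forall>x\<in>W. \<bar>\<phi> x\<bar> \<le> norm \<phi> * norm x"
    using norm_blinfun[of \<phi>] by simp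
  then show ?thesis
    using assms
    by (auto simp: subspace_dual_def subspace_add subspace_scale blinfun.add_right blinfun.scaleR_right)
qed

lemma le_subspace_dual_dist_restrict:
  fixes \<phi> \<psi> :: "'v::real_normed_vector \<Rightarrow>\<^sub>L real"
  assumes W: "subspace W" and w: "w \<in> W" "norm w \<le> 1"
  shows "\<bar>\<phi> w - \<psi> w\<bar> \<le> subspace_dual_dist W (restrict \<phi> W) (restrict \<psi> W)"
proof -
  let ?B = "{w\<in>W. norm w \<le> 1}"
  have "\<bar>\<phi> x - \<psi> x\<bar> \<le> norm (\<phi> - \<psi>)" if "x \<in> ?B" for x
    using norm_blinfun[of "\<phi> - \<psi>" x] that mult_left_le[of "norm x" "norm (\<phi> - \<psi>)"]
    by (simp add: blinfun.diff_left)
  then have "bdd_above ((\<lambda>x. \<bar>\<phi> x - \<psi> x\<bar>) ` ?B)"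
    by (rule bdd_aboveI2)
  then have "\<bar>\<phi> w - \<psi> w\<bar> \<le> (SUP x\<in>?B. \<bar>\<phi> x - \<psi> x\<bar>)"
    using w by (intro cSUP_upper) auto
  also have "\<dots> = (SUP x\<in>?B. \<bar>restrict \<phi> W x - restrict \<psi> W x\<bar>)"
    by (intro SUP_cong) auto
  finally show ?thesis
    by (simp add: subspace_dual_dist_def restrict_blinfun_in_subspace_dual[OF W])
qed

text \<open>
  The Asplund property speaks of separable subspaces only, while the norm of \<open>\<alpha> x - \<alpha> y\<close> is a
  supremum over the unit ball of the whole space. The two are linked by a countable subset \<open>J\<close> of the
  ball whose functions on \<open>X\<close> are pointwise dense: approximating at the two points \<open>x\<close> and \<open>y\<close>
  simultaneously shows that the supremum may be taken over \<open>J\<close>, for all pairs \<open>x\<close>, \<open>y\<close> at once.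
\<close>

lemma Asplund_imp_norm_separable_image:
  fixes \<alpha> :: "'x \<Rightarrow> ('v::banach \<Rightarrow>\<^sub>L real)"
  assumes V: "Asplund TYPE('v)"
    and X: "second_countable X"
    and \<alpha>: "continuous_map X weak_star_topology \<alpha>"
  obtains D where "countable D" "D \<subseteq> topspace X"
    "\<And>x e. x \<in> topspace X \<Longrightarrow> e > 0 \<Longrightarrow> \<exists>d\<in>D. norm (\<alpha> x - \<alpha> d) < e"
proof -
  have cont: "continuous_map X euclidean (\<lambda>x. \<alpha> x v)" for v
    using continuous_map_compose[OF \<alpha> strong_operator_topology_continuous_evaluation[of v]]
    by (simp add: o_def)
  obtain J where J: "J \<subseteq> {v::'v. norm v \<le> 1}" "countable J"
    "\<And>v F e. v \<in> {v. norm v \<le> 1} \<Longrightarrow> finite F \<Longrightarrow> F \<subseteq> topspace X \<Longrightarrow> e > 0 \<Longrightarrow>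
      \<exists>j\<in>J. \<forall>x\<in>F. \<bar>\<alpha> x j - \<alpha> x v\<bar> < e"
    using countable_pointwise_dense_subfamily[OF X, of "{v. norm v \<le> 1}" "\<lambda>v x. \<alpha> x v"] cont
    by blast
  obtain W where W: "subspace W" "closed W" "separable_space (top_of_set W)" "J \<subseteq> W"
    using ex_separable_subspace_superset[OF J(2)] by blast
  interpret Metric_space "subspace_dual W" "subspace_dual_dist W"
    by (rule Metric_space_subspace_dual[OF W(1)])
  let ?r = "\<lambda>x. restrict (\<alpha> x) W"
  have norm_le: "norm (\<alpha> x - \<alpha> y) \<le> subspace_dual_dist W (?r x) (?r y)"
    if xy: "x \<in> topspace X" "y \<in> topspace X" for x y
  proof (rule norm_blinfun_bound)
    let ?d = "subspace_dual_dist W (?r x) (?r y)"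
    show "0 \<le> ?d"
      by simp
    have unit: "\<bar>\<alpha> x u - \<alpha> y u\<bar> \<le> ?d" if u: "norm u \<le> 1" for u
    proof (rule field_le_epsilon)
      fix e :: real assume "e > 0"
      then obtain j where j: "j \<in> J" "\<bar>\<alpha> x j - \<alpha> x u\<bar> < e / 2" "\<bar>\<alpha> y j - \<alpha> y u\<bar> < e / 2"
        using J(3)[of u "{x, y}" "e / 2"] u xy by auto
      have "\<bar>\<alpha> x j - \<alpha> y j\<bar> \<le> ?d"
        using j J(1) W by (intro le_subspace_dual_dist_restrict) auto
      then show "\<bar>\<alpha> x u - \<alpha> y u\<bar> \<le> ?d + e"
        using j by linarith
    qed
    show "norm ((\<alpha> x - \<alpha> y) v) \<le> ?d * norm v" for v
    proof (cases "v = 0")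
      case False
      define u where "u = inverse (norm v) *\<^sub>R v"
      have v: "v = norm v *\<^sub>R u" and u: "norm u \<le> 1"
        using False by (auto simp: u_def)
      have "(\<alpha> x - \<alpha> y) v = norm v * (\<alpha> x u - \<alpha> y u)"
        by (subst v) (simp add: blinfun.scaleR_right blinfun.diff_left)
      then show ?thesis
        using mult_left_mono[OF unit[OF u], of "norm v"] by (simp add: abs_mult mult.commute)
    qed simp
  qed
  let ?M = "subtopology mtopology (?r ` topspace X)"
  have dual: "?r ` topspace X \<subseteq> subspace_dual W"
    using restrict_blinfun_in_subspace_dual[OF W(1)] by blast
  have "separable_space mtopology"
    using V W unfolding Asplund_def by blast
  then have "separable_space ?M"
    by (rule second_countable_imp_separable_space[OF second_countable_subtopology[OF second_countable_mtopology]])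
  then obtain C where C: "countable C" "C \<subseteq> topspace ?M" "?M closure_of C = topspace ?M"
    unfolding separable_space_def by blast
  have "C \<subseteq> ?r ` topspace X"
    using C(2) by auto
  then obtain D where D: "countable D" "D \<subseteq> topspace X" "C = ?r ` D"
    using C(1) countable_subset_image[of C ?r "topspace X"] by blast
  have "\<exists>d\<in>D. norm (\<alpha> x - \<alpha> d) < e" if x: "x \<in> topspace X" and e: "e > 0" for x e
  proof -
    have "?r x \<in> ?M closure_of C"
      unfolding C(3) using x dual by auto
    then have "?r x \<in> mtopology closure_of C"
      by (simp add: closure_of_subtopology_subset[THEN subsetD])
    then obtain c where "c \<in> C" "c \<in> mball (?r x) e"
      unfolding metric_closure_of using e by blast
    then obtain d where "d \<in> D" "subspace_dual_dist W (?r x) (?r d) < e"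
      using D by auto
    then show ?thesis
      using norm_le[OF x, of d] D by force
  qed
  then show thesis
    using D by (intro that[of D]) auto
qed

section \<open>The enveloping semigroup of a metrizable RN system\<close>

lemma metrizable_enveloping_semigroup:
  fixes V :: "'v::banach itself"
    and X :: "'x topology"
    and act :: "'g::topological_group_add \<Rightarrow> 'x \<Rightarrow> 'x"
  assumes RN: "RN_system_on V X act"
    and metric: "metrizable_space X"
  shows "metrizable_space (enveloping_semigroup X act)"
proof -
  have sys: "compact_G_system X act" and Asp: "Asplund TYPE('v)"
    using RN by (simp_all add: RN_system_on_def Asplund_def)
  obtain h :: "'g \<Rightarrow> 'v \<Rightarrow> 'v" and \<alpha> :: "'x \<Rightarrow> ('v \<Rightarrow>\<^sub>L real)" where
    h: "strongly_continuous_cohom h" and emb: "embedding_map X weak_star_topology \<alpha>"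
    and equi: "\<And>g x v. x \<in> topspace X \<Longrightarrow> \<alpha> (act g x) v = \<alpha> x (h g v)"
    using RN unfolding RN_system_on_def by blast
  have \<alpha>: "continuous_map X weak_star_topology \<alpha>" and inj: "inj_on \<alpha> (topspace X)"
    using emb unfolding embedding_map_def
    by (auto dest: homeomorphic_imp_continuous_map homeomorphic_imp_injective_map
        simp: continuous_map_in_subtopology)
  have cont: "continuous_map X euclidean (\<lambda>x. \<alpha> x v)" for v
    using continuous_map_compose[OF \<alpha> strong_operator_topology_continuous_evaluation[of v]]
    by (simp add: o_def)
  have act_in: "act g x \<in> topspace X" if "x \<in> topspace X" for g x
    using continuous_map_image_subset_topspace[of "prod_topology euclidean X" X "\<lambda>(g, x). act g x"]
      sys that by (force simp: compact_G_system_def)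
  obtain D where D: "countable D" "D \<subseteq> topspace X"
    "\<And>x e. x \<in> topspace X \<Longrightarrow> e > 0 \<Longrightarrow> \<exists>d\<in>D. norm (\<alpha> x - \<alpha> d) < e"
    using Asplund_imp_norm_separable_image[OF Asp _ \<alpha>]
      compact_metrizable_imp_second_countable[OF _ metric] sys
    unfolding compact_G_system_def by blast
  define P where "P = product_topology (\<lambda>_::'x. X) (topspace X)"
  define T where "T = range (\<lambda>g. restrict (act g) (topspace X))"
  define E where "E = enveloping_semigroup X act"
  have E: "E = subtopology P (P closure_of T)"
    by (simp add: E_def enveloping_semigroup_def P_def T_def Let_def)
  have tE: "topspace E = P closure_of T"
    by (simp add: E closure_of_subset_topspace Int_absorb1)
  have EP: "topspace E \<subseteq> topspace X \<rightarrow>\<^sub>E topspace X"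
    using closure_of_subset_topspace[of P T] by (simp add: tE P_def)
  have contP: "continuous_map P X (\<lambda>p. p x)" if "x \<in> topspace X" for x
    unfolding P_def by (rule continuous_map_product_projection[OF that])
  \<comment> \<open>For fixed \<open>x\<close>, \<open>y\<close>, \<open>v\<close>, the estimate defines a closed set of selfmaps, and it holds for the
    translations because \<open>h g\<close> preserves the norm of \<open>v\<close>.\<close>
  have Lipschitz: "\<bar>\<alpha> (p x) v - \<alpha> (p y) v\<bar> \<le> norm (\<alpha> x - \<alpha> y) * norm v"
    if p: "p \<in> topspace E" and x: "x \<in> topspace X" and y: "y \<in> topspace X" for p x y v
  proof -
    let ?S = "{p\<in>topspace P. \<bar>\<alpha> (p x) v - \<alpha> (p y) v\<bar> \<in> {..norm (\<alpha> x - \<alpha> y) * norm v}}"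
    have "continuous_map P euclidean (\<lambda>p. \<alpha> (p z) v)" if "z \<in> topspace X" for z
      using continuous_map_compose[OF contP[OF that] cont[of v]] by (simp add: o_def)
    then have "continuous_map P euclidean (\<lambda>p. \<bar>\<alpha> (p x) v - \<alpha> (p y) v\<bar>)"
      using x y by (intro continuous_map_real_abs continuous_map_diff) auto
    then have "closedin P ?S"
      by (rule closedin_continuous_map_preimage) simp
    moreover have "T \<subseteq> ?S"
    proof -
      have "\<bar>\<alpha> (act g x) v - \<alpha> (act g y) v\<bar> \<le> norm (\<alpha> x - \<alpha> y) * norm v" for g
      proof -
        have "norm (h g v) = norm v"
          using h by (simp add: strongly_continuous_cohom_def linear_isometry_onto_def)
        then show ?thesis
          using norm_blinfun[of "\<alpha> x - \<alpha> y" "h g v"] x y by (simp add: equi blinfun.diff_left)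
      qed
      then show ?thesis
        using x y act_in by (auto simp: T_def P_def)
    qed
    ultimately have "P closure_of T \<subseteq> ?S"
      by (rule closure_of_minimal[rotated])
    then show ?thesis
      using p by (auto simp: tE)
  qed
  have eqI: "p = q"
    if p: "p \<in> topspace E" and q: "q \<in> topspace E" and pq: "\<And>d. d \<in> D \<Longrightarrow> p d = q d" for p q
  proof (rule PiE_ext)
    show "p \<in> topspace X \<rightarrow>\<^sub>E topspace X" "q \<in> topspace X \<rightarrow>\<^sub>E topspace X"
      using p q EP by auto
    fix x assume x: "x \<in> topspace X"
    have "\<alpha> (p x) v = \<alpha> (q x) v" for v
    proof -
      have "\<bar>\<alpha> (p x) v - \<alpha> (q x) v\<bar> \<le> 0 + e" if "e > 0" for e
      proof -
        define c where "c = norm v + 1"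
        define \<delta> where "\<delta> = e / (2 * c)"
        have c: "c > 0" "norm v \<le> c"
          by (simp_all add: c_def add_nonneg_pos)
        have "\<delta> > 0"
          using \<open>e > 0\<close> c by (simp add: \<delta>_def)
        then obtain d where d: "d \<in> D" "norm (\<alpha> x - \<alpha> d) < \<delta>"
          using D(3) x by blast
        have dX: "d \<in> topspace X"
          using d D by auto
        have "norm (\<alpha> x - \<alpha> d) * norm v \<le> \<delta> * c"
          using c d \<open>\<delta> > 0\<close> by (intro mult_mono) auto
        also have "\<dots> = e / 2"
          using c by (simp add: \<delta>_def)
        finally show ?thesis
          using Lipschitz[OF p x dX, of v] Lipschitz[OF q x dX, of v] pq[OF d(1)] by simp
      qed
      then have "\<bar>\<alpha> (p x) v - \<alpha> (q x) v\<bar> \<le> 0"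
        by (rule field_le_epsilon)
      then show ?thesis by simp
    qed
    then have "\<alpha> (p x) = \<alpha> (q x)"
      by (rule blinfun_eqI)
    then show "p x = q x"
      using inj p q EP x by (auto dest: inj_onD)
  qed
  let ?Z = "product_topology (\<lambda>_. X) D"
  have "continuous_map E ?Z (\<lambda>p. restrict p D)"
    unfolding continuous_map_componentwise
  proof (intro conjI ballI)
    show "(\<lambda>p. restrict p D) ` topspace E \<subseteq> extensional D"
      by auto
    fix d assume "d \<in> D"
    then show "continuous_map E X (\<lambda>p. restrict p D d)"
      using contP[of d] D by (auto simp: E intro: continuous_map_from_subtopology)
  qed
  moreover have "compact_space E"
    using compact_G_system_enveloping_semigroup[OF sys] by (simp add: E_def compact_G_system_def)
  moreover have "Hausdorff_space ?Z"
    using sys by (auto simp: compact_G_system_def Hausdorff_space_product_topology)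
  moreover have "inj_on (\<lambda>p. restrict p D) (topspace E)"
    by (rule inj_onI) (metis eqI restrict_apply')
  ultimately have "embedding_map E ?Z (\<lambda>p. restrict p D)"
    by (rule continuous_imp_embedding_map)
  then have "E homeomorphic_space subtopology ?Z ((\<lambda>p. restrict p D) ` topspace E)"
    by (rule embedding_map_imp_homeomorphic_space)
  moreover have "metrizable_space ?Z"
    using D(1) metric by (auto simp: metrizable_space_product_topology)
  ultimately show ?thesis
    unfolding E_def[symmetric]
    using homeomorphic_metrizable_space metrizable_space_subtopology by blast
qed

section \<open>Passing to a system on singletons\<close>

lemma compact_G_system_homeomorphic:
  assumes X: "compact_G_system X act" and f: "homeomorphic_maps X Y f f'"
  shows "compact_G_system Y (\<lambda>g y. f (act g (f' y)))"
proof -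
  have hom: "X homeomorphic_space Y"
    using f by (auto simp: homeomorphic_space_def)
  have cf: "continuous_map X Y f" and cf': "continuous_map Y X f'"
    and ff': "\<And>x. x \<in> topspace X \<Longrightarrow> f' (f x) = x" "\<And>y. y \<in> topspace Y \<Longrightarrow> f (f' y) = y"
    using f by (auto simp: homeomorphic_maps_def)
  have cact: "continuous_map (prod_topology euclidean X) X (\<lambda>(g, x). act g x)"
    using X by (simp add: compact_G_system_def)
  have f'_in: "f' y \<in> topspace X" if "y \<in> topspace Y" for y
    using cf' that by (auto simp: continuous_map_def)
  have act_in: "act g x \<in> topspace X" if "x \<in> topspace X" for g x
    using continuous_map_image_subset_topspace[OF cact] that by force
  have "continuous_map (prod_topology euclidean Y) (prod_topology euclidean X) (\<lambda>z. (fst z, f' (snd z)))"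
    using continuous_map_compose[OF continuous_map_snd cf']
    by (intro continuous_map_pairedI continuous_map_fst) (simp add: o_def)
  from continuous_map_compose[OF continuous_map_compose[OF this cact] cf]
  have "continuous_map (prod_topology euclidean Y) Y (\<lambda>(g, y). f (act g (f' y)))"
    by (simp add: o_def split_beta')
  then show ?thesis
    using X homeomorphic_compact_space[OF hom] homeomorphic_Hausdorff_space[OF hom]
    by (simp add: compact_G_system_def f'_in act_in ff')
qed

text \<open>
  The factor is to be a topology on the type of sets of points, so a space that serves as its own
  factor is replaced by the homeomorphic space of its singletons.
\<close>

lemma homeomorphic_maps_singletons:
  "homeomorphic_maps X (pullback_topology (range (\<lambda>x. {x})) the_elem X) (\<lambda>x. {x}) the_elem"
proof -
  have "continuous_map X (pullback_topology (range (\<lambda>x. {x})) the_elem X) (\<lambda>x. {x})"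
    by (rule continuous_map_pullback') (auto simp: o_def)
  moreover have "continuous_map (pullback_topology (range (\<lambda>x. {x})) the_elem X) X the_elem"
    using continuous_map_pullback[of X X "\<lambda>x. x" "range (\<lambda>x. {x})" the_elem] by (simp add: o_def)
  ultimately show ?thesis
    by (auto simp: homeomorphic_maps_def topspace_pullback_topology)
qed

theorem corollary15p2:
  fixes V :: "'v::banach itself"
    and X :: "'x topology"
    and act :: "'g::topological_group_add \<Rightarrow> 'x \<Rightarrow> 'x"
  assumes RN: "RN_system_on V X act"
    and metric: "metrizable_space X"
  defines "E \<equiv> enveloping_semigroup X act"
  shows "(\<exists>D. D \<subseteq> topspace E \<and> uncountable D \<and> subtopology E D = discrete_topology D) \<or>
         (\<exists>(Y :: ('x \<Rightarrow> 'x) set topology) act' \<pi>.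
            G_factor E (enveloping_act X act) Y act' \<pi> \<and> metrizable_space Y \<and>
            (\<forall>y\<in>topspace Y. finite {p \<in> topspace E. \<pi> p = y} \<and> card {p \<in> topspace E. \<pi> p = y} \<le> 2))"
proof (rule disjI2)
  define Y where "Y = pullback_topology (range (\<lambda>p. {p})) the_elem E"
  define act' where "act' g y = {enveloping_act X act g (the_elem y)}" for g y
  have hom: "homeomorphic_maps E Y (\<lambda>p. {p}) the_elem"
    unfolding Y_def by (rule homeomorphic_maps_singletons)
  have sys: "compact_G_system E (enveloping_act X act)"
    unfolding E_def using RN by (intro compact_G_system_enveloping_semigroup) (simp add: RN_system_on_def)
  have "G_factor E (enveloping_act X act) Y act' (\<lambda>p. {p})"
    unfolding G_factor_def
  proof (intro conjI allI ballI)
    show "compact_G_system Y act'"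
      using compact_G_system_homeomorphic[OF sys hom] by (simp add: act'_def[abs_def])
    show "continuous_map E Y (\<lambda>p. {p})"
      using hom by (simp add: homeomorphic_maps_def)
    show "(\<lambda>p. {p}) ` topspace E = topspace Y"
      by (auto simp: Y_def topspace_pullback_topology)
  qed (simp add: act'_def)
  moreover have "metrizable_space Y"
    using homeomorphic_metrizable_space[of E Y] hom metrizable_enveloping_semigroup[OF RN metric]
    by (auto simp: E_def homeomorphic_space_def)
  moreover have "finite {p \<in> topspace E. {p} = y} \<and> card {p \<in> topspace E. {p} = y} \<le> 2" for y
  proof -
    have sub: "{p \<in> topspace E. {p} = y} \<subseteq> {the_elem y}"
      by auto
    from card_mono[OF _ sub] finite_subset[OF sub] show ?thesis
      by simp
  qed
  ultimately show "\<exists>(Y :: ('x \<Rightarrow> 'x) set topology) act' \<pi>.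
      G_factor E (enveloping_act X act) Y act' \<pi> \<and> metrizable_space Y \<and>
      (\<forall>y\<in>topspace Y. finite {p \<in> topspace E. \<pi> p = y} \<and> card {p \<in> topspace E. \<pi> p = y} \<le> 2)"
    by blast
qed

end
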